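(* Consider the fully discrete implicit-explicit scheme described in the context: $u^0_{i,j}=g_0'(x_{1_i},x_{2_j})$ and, for $n\ge1$, $$\frac{u^n_{i,j}-u^{n-1}_{i,j}}{\triangle\tau}+(B_{\rho'}u^n)_{i,j}+ru^n_{i,j}=(Ku^{n-1})_{i,j}+F^n_{i,j}$$ at the inner nodes and at the nodes of the Neumann part $\partial\Omega_1'$ of the boundary, with $u^n_{i,j}=g_2'(x_{1_i},x_{2_j},\tau_n)$ at the nodes of the Dirichlet part $\partial\Omega_2'$. Suppose that $\partial\Omega_1=\emptyset$, or $\partial\Omega_1\ne\emptyset$ and $g_1=0$; that $g_0\ge0$ and $g_2\ge0$; that $$\frac{\sigma_1}{\sigma_2}\max_{\substack{1+b_W\le i\le N_1-b_E\\ 1+b_S\le j\le N_2-b_N}}|\rho'_{i,j}|\ \le\ \frac{h_1}{h_2}\ \le\ \frac{\sigma_1}{\sigma_2\max\limits_{\substack{1+b_W\le i\le N_1-b_E\\ 1+b_S\le j\le N_2-b_N}}|\rho'_{i,j}|},$$ where $b_Q=1$ if $\partial\Omega'_Q\subseteq\partial\Omega'_2$ and $b_Q=0$ otherwise, $Q\in\{W,E,N,S\}$; and that $$\triangle\tau\le\frac{h_1h_2}{2(|A_1|h_2+|A_2|h_1)}.$$ Then the numerical solution of the transformed problem for $u$ (respectively of the original problem for $V$) obtained by this scheme is stable, in the maximal discrete norm $\|u\|=\max_{i,j}|u_{i,j}|$, with respect to the initial and boundary conditions.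
   Context: Meaning of the conclusion: the paper gives no separate definition of stability; the estimate with which its proof ends is $\|u\|\le\max\{\|g_0'\|,\,T\max_{\partial\Omega_2'}g_2'\}$. Parameters: volatilities $\sigma_1,\sigma_2>0$, interest rate $r>0$, dividends $D_1,D_2$, maturity $T$, correlation bounds $-1\le\rho_1\le\rho_2\le1$; $A_s=r-D_s-\frac12\sigma_s^2$, $s=1,2$. For real $v$: $v^+=\max\{0,v\}$, $v^-=\max\{0,-v\}$, so $v=v^+-v^-$, $|v|=v^++v^-$. Let $\rho(\gamma)=\rho_1$ for $\gamma>0$ and $\rho(\gamma)=\rho_2$ for $\gamma<0$. Original problem: on $\Omega=(L_W,L_E)\times(L_S,L_N)\subseteq\mathbb{R}^+\times\mathbb{R}^+$, $0\le t<T$, the worst-case two-asset option price $V(S_1,S_2,t)$ satisfies $V_t+\frac12\sigma_1^2S_1^2V_{S_1S_1}+\frac12\sigma_2^2S_2^2V_{S_2S_2}+\rho(V_{S_1S_2})\sigma_1\sigma_2S_1S_2V_{S_1S_2}+(r-D_1)S_1V_{S_1}+(r-D_2)S_2V_{S_2}-rV=0$, $V(\cdot,T)=g_0$ in $\Omega$, outward normal derivative $=g_1$ on $\partial\Omega_1$, $V=g_2$ on $\partial\Omega_2\ne\emptyset$, $\partial\Omega_1\cup\partial\Omega_2=\partial\Omega$; each side of the rectangle belongs to $\partial\Omega_1$ or to $\partial\Omega_2$. Transformed problem: with $x_i=\ln S_i$, $\tau=T-t$, $u(x_1,x_2,\tau)=V(S_1,S_2,t)$: $u_\tau-\frac12\sigma_1^2u_{x_1x_1}-\frac12\sigma_2^2u_{x_2x_2}-\rho(u_{x_1x_2})\sigma_1\sigma_2u_{x_1x_2}-A_1u_{x_1}-A_2u_{x_2}+ru=0$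 on $\Omega'=(\ln L_W,\ln L_E)\times(\ln L_S,\ln L_N)$, $0<\tau<T$, $u(\cdot,0)=g_0'$, outward normal derivative $=g_1'$ on $\partial\Omega_1'$, $u=g_2'$ on $\partial\Omega_2'$. Primes denote transformed objects: $g_0'(x_1,x_2)=g_0(e^{x_1},e^{x_2})$, $g_2'(x_1,x_2,\tau)=g_2(e^{x_1},e^{x_2},\tau)$, $g_1'=e^{x_1}g_1$ on the West/East sides and $g_1'=e^{x_2}g_1$ on the South/North sides. The sides are $\partial\Omega'_W$ ($x_1=\ln L_W$), $\partial\Omega'_E$ ($x_1=\ln L_E$), $\partial\Omega'_S$ ($x_2=\ln L_S$), $\partial\Omega'_N$ ($x_2=\ln L_N$). Mesh: nodes $(x_{1_i},x_{2_j})$, $x_{1_i}=\ln L_W+(i-1)h_1$, $x_{2_j}=\ln L_S+(j-1)h_2$, $1\le i\le N_1$, $1\le j\le N_2$, $h_1=(\ln L_E-\ln L_W)/(N_1-1)$, $h_2=(\ln L_N-\ln L_S)/(N_2-1)$; $\tau_n=n\triangle\tau\in[0,T]$. Differences: $u_{\overline{x}_1}=(u_{i,j}-u_{i-1,j})/h_1$, $u_{x_1}=(u_{i+1,j}-u_{i,j})/h_1$, $u_{\mathring{x}_1}=\frac12(u_{x_1}+u_{\overline{x}_1})$, similarly in $x_2$ with $j,h_2$; iterated subscripts denote composition; $u^+_{x_1x_2}=\frac12(u_{x_1x_2}+u_{\overline{x}_1\overline{x}_2})$, $u^-_{x_1x_2}=\frac12(u_{\overline{x}_1x_2}+u_{x_1\overline{x}_2})$.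 Flux limiter (van Leer): $\Phi(\theta)=\frac{|\theta|+\theta}{1+|\theta|}$. For $s=1$, $\theta_{e_1+1/2}=u_{x_1}/u_{\overline{x}_1}$ at $(i,j)$, and $\theta_{e_1+3/2},\theta_{e_1-1/2}$ are the same ratio at $(i+1,j),(i-1,j)$; analogously for $s=2$ in $j$. $\Lambda_s^+=1+\frac12\Phi(\theta_{e_s+1/2}^{-1})-\frac12\Phi(\theta_{e_s+3/2})$, $\Lambda_s^-=1+\frac12\Phi(\theta_{e_s+1/2})-\frac12\Phi(\theta_{e_s-1/2}^{-1})$, so $0\le\Lambda_s^\pm\le2$. Outer values needed in these ratios are extrapolated: $u_{0,j}=3u_{1,j}-3u_{2,j}+u_{3,j}$, $u_{N_1+1,j}=3u_{N_1,j}-3u_{N_1-1,j}+u_{N_1-2,j}$, and likewise in $j$. Time levels: in the step from $\tau_{n-1}$ to $\tau_n$, $\rho'_{i,j}$ and $\Lambda_s^\pm$ are evaluated at $\tau_{n-1}$, $K$ acts on $u^{n-1}$ and $B_{\rho'}$ on $u^n$. Scheme (write $\rho'=\rho'_{i,j}$, $\kappa=\sigma_1\sigma_2$, $K_1=A_1^+\Lambda_1^+u_{x_1}-A_1^-\Lambda_1^-u_{\overline{x}_1}$, $K_2=A_2^+\Lambda_2^+u_{x_2}-A_2^-\Lambda_2^-u_{\overline{x}_2}$). The term $F^n$ is zero at inner nodes and, at Neumann nodes, is linear in the Neumann datum $g_1'$; since $g_1=0$ on any Neumann side here, $F^n=0$ everywhere. At Neumann nodes $\rho'$ is the value of $\rho$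 at the discrete mixed derivative computed from $g_1'$. Inner nodes ($2\le i\le N_1-1$, $2\le j\le N_2-1$): $B_{\rho'}u=-\frac12\sigma_1^2u_{\overline{x}_1x_1}-\frac12\sigma_2^2u_{\overline{x}_2x_2}-\kappa(\rho'^+u^+_{x_1x_2}-\rho'^-u^-_{x_1x_2})$, $Ku=K_1+K_2$, $\rho'=\rho(u_{\mathring{x}_1\mathring{x}_2})$. West Neumann side ($i=1$, $1<j<N_2$): $B_{\rho'}u=-\frac{\sigma_1^2}{h_1}u_{x_1}-\frac12\sigma_2^2u_{\overline{x}_2x_2}-\frac{\kappa}{2}|\rho'|(u_{x_1x_2}-u_{x_1\overline{x}_2})$, $Ku=A_1^+\Lambda_1^+u_{x_1}+K_2$. East Neumann side ($i=N_1$, $1<j<N_2$): $B_{\rho'}u=\frac{\sigma_1^2}{h_1}u_{\overline{x}_1}-\frac12\sigma_2^2u_{\overline{x}_2x_2}-\frac{\kappa}{2}|\rho'|(u_{\overline{x}_1\overline{x}_2}-u_{\overline{x}_1x_2})$, $Ku=-A_1^-\Lambda_1^-u_{\overline{x}_1}+K_2$. North Neumann side ($j=N_2$, $1<i<N_1$): $B_{\rho'}u=-\frac12\sigma_1^2u_{\overline{x}_1x_1}+\frac{\sigma_2^2}{h_2}u_{\overline{x}_2}-\frac{\kappa}{2}|\rho'|(u_{\overline{x}_1\overline{x}_2}-u_{x_1\overline{x}_2})$, $Ku=K_1-A_2^-\Lambda_2^-u_{\overline{x}_2}$. South Neumann side ($j=1$, $1<i<N_1$): $B_{\rho'}u=-\frac12\sigma_1^2u_{\overline{x}_1x_1}-\frac{\sigma_2^2}{h_2}u_{x_2}-\frac{\kappa}{2}|\rho'|(u_{x_1x_2}-u_{\overline{x}_1x_2})$,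 $Ku=K_1+A_2^+\Lambda_2^+u_{x_2}$. Corners where two Neumann sides meet: NW $(1,N_2)$: $B_{\rho'}u=-\frac{\sigma_1^2}{h_1}u_{x_1}+\frac{\sigma_2^2}{h_2}u_{\overline{x}_2}+\kappa|\rho'|u_{x_1\overline{x}_2}$, $Ku=A_1^+\Lambda_1^+u_{x_1}-A_2^-\Lambda_2^-u_{\overline{x}_2}$. NE $(N_1,N_2)$: $B_{\rho'}u=\frac{\sigma_1^2}{h_1}u_{\overline{x}_1}+\frac{\sigma_2^2}{h_2}u_{\overline{x}_2}-\kappa|\rho'|u_{\overline{x}_1\overline{x}_2}$, $Ku=-A_1^-\Lambda_1^-u_{\overline{x}_1}-A_2^-\Lambda_2^-u_{\overline{x}_2}$. SE $(N_1,1)$: $B_{\rho'}u=\frac{\sigma_1^2}{h_1}u_{\overline{x}_1}-\frac{\sigma_2^2}{h_2}u_{x_2}+\kappa|\rho'|u_{\overline{x}_1x_2}$, $Ku=-A_1^-\Lambda_1^-u_{\overline{x}_1}+A_2^+\Lambda_2^+u_{x_2}$. SW $(1,1)$: $B_{\rho'}u=-\frac{\sigma_1^2}{h_1}u_{x_1}-\frac{\sigma_2^2}{h_2}u_{x_2}-\kappa|\rho'|u_{x_1x_2}$, $Ku=A_1^+\Lambda_1^+u_{x_1}+A_2^+\Lambda_2^+u_{x_2}$.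
   Formalization: Stability is taken as ‖u‖ ≤ max{‖g_0'‖, max g_2'}, without the factor T before max g_2' in the estimate ending the paper's proof; that estimate fails for T<1 (g_0=0, g_2=1, T=1/2) and follows from this one for T≥1. *)

theory Defs
  imports Complex_Main
begin

datatype side = West | East | South | North

text \<open>
  The sides in \<open>dirichlet\<close> make up the Dirichlet part of the boundary, the others the Neumann part.
  \<open>rho1\<close> and \<open>rho2\<close> are the correlations for positive and negative mixed derivative; \<open>rho0\<close> is
  the value used when the mixed derivative vanishes.
  The last argument of \<open>g1\<close> and \<open>g2\<close> is the time to maturity.
\<close>

record option_problem =
  sigma1 :: real
  sigma2 :: real
  rate :: real
  div1 :: real
  div2 :: real
  maturity :: real
  rho1 :: real
  rho2 :: real
  rho0 :: real
  LW :: real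
  LE :: real
  LS :: real
  LN :: real
  dirichlet :: "side set"
  g0 :: "real \<Rightarrow> real \<Rightarrow> real"
  g1 :: "real \<Rightarrow> real \<Rightarrow> real \<Rightarrow> real"
  g2 :: "real \<Rightarrow> real \<Rightarrow> real \<Rightarrow> real"
  N1 :: nat
  N2 :: nat
  dt :: real

definition pos :: "real \<Rightarrow> real" where "pos v = max 0 v"
definition neg :: "real \<Rightarrow> real" where "neg v = max 0 (- v)"

definition A1 :: "option_problem \<Rightarrow> real" where
  "A1 P = rate P - div1 P - (sigma1 P)\<^sup>2 / 2"
definition A2 :: "option_problem \<Rightarrow> real" where
  "A2 P = rate P - div2 P - (sigma2 P)\<^sup>2 / 2"

definition kappa :: "option_problem \<Rightarrow> real" where
  "kappa P = sigma1 P * sigma2 P"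

definition rho :: "option_problem \<Rightarrow> real \<Rightarrow> real" where
  "rho P \<gamma> = (if \<gamma> > 0 then rho1 P else if \<gamma> < 0 then rho2 P else rho0 P)"


section \<open>Domain and mesh\<close>

definition closed_domain :: "option_problem \<Rightarrow> (real \<times> real) set" where
  "closed_domain P = {LW P..LE P} \<times> {LS P..LN P}"

fun side_points :: "option_problem \<Rightarrow> side \<Rightarrow> (real \<times> real) set" where
  "side_points P West = {LW P} \<times> {LS P..LN P}"
| "side_points P East = {LE P} \<times> {LS P..LN P}"
| "side_points P South = {LW P..LE P} \<times> {LS P}"
| "side_points P North = {LW P..LE P} \<times> {LN P}"

definition h1 :: "option_problem \<Rightarrow> real" where
  "h1 P = (ln (LE P) - ln (LW P)) / (real (N1 P) - 1)"
definition h2 :: "option_problem \<Rightarrow> real" where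
  "h2 P = (ln (LN P) - ln (LS P)) / (real (N2 P) - 1)"

definition x1 :: "option_problem \<Rightarrow> nat \<Rightarrow> real" where
  "x1 P i = ln (LW P) + (real i - 1) * h1 P"
definition x2 :: "option_problem \<Rightarrow> nat \<Rightarrow> real" where
  "x2 P j = ln (LS P) + (real j - 1) * h2 P"

definition tau :: "option_problem \<Rightarrow> nat \<Rightarrow> real" where
  "tau P n = real n * dt P"

definition nodes :: "option_problem \<Rightarrow> (nat \<times> nat) set" where
  "nodes P = {1..N1 P} \<times> {1..N2 P}"

definition inner_nodes :: "option_problem \<Rightarrow> (nat \<times> nat) set" where
  "inner_nodes P = {2..N1 P - 1} \<times> {2..N2 P - 1}"

fun side_nodes :: "option_problem \<Rightarrow> side \<Rightarrow> (nat \<times> nat) set" where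
  "side_nodes P West = {1} \<times> {1..N2 P}"
| "side_nodes P East = {N1 P} \<times> {1..N2 P}"
| "side_nodes P South = {1..N1 P} \<times> {1}"
| "side_nodes P North = {1..N1 P} \<times> {N2 P}"

text \<open>A corner in which a Dirichlet side meets a Neumann side carries the Dirichlet condition.\<close>

definition dirichlet_nodes :: "option_problem \<Rightarrow> (nat \<times> nat) set" where
  "dirichlet_nodes P = (\<Union>Q\<in>dirichlet P. side_nodes P Q)"

definition neumann_nodes :: "option_problem \<Rightarrow> (nat \<times> nat) set" where
  "neumann_nodes P = (\<Union>Q\<in>- dirichlet P. side_nodes P Q) - dirichlet_nodes P"


section \<open>Transformed data\<close>

definition g0' :: "option_problem \<Rightarrow> real \<Rightarrow> real \<Rightarrow> real" where
  "g0' P y1 y2 = g0 P (exp y1) (exp y2)"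

definition g2' :: "option_problem \<Rightarrow> real \<Rightarrow> real \<Rightarrow> real \<Rightarrow> real" where
  "g2' P y1 y2 t = g2 P (exp y1) (exp y2) t"

definition g1' :: "option_problem \<Rightarrow> side \<Rightarrow> real \<Rightarrow> real \<Rightarrow> real \<Rightarrow> real" where
  "g1' P Q y1 y2 t =
     (if Q = West \<or> Q = East then exp y1 else exp y2) * g1 P (exp y1) (exp y2) t"

text \<open>
  Mesh values of the transformed Neumann datum, extended by zero. They are indexed by the side
  because the datum is two-valued at a corner of two Neumann sides.
\<close>

type_synonym neumann_data = "side \<Rightarrow> nat \<Rightarrow> nat \<Rightarrow> nat \<Rightarrow> real"

definition neumann_datum :: "option_problem \<Rightarrow> neumann_data" where
  "neumann_datum P Q n i j =
     (if Q \<notin> dirichlet P \<and> (i, j) \<in> side_nodes P Q \<and> tau P n \<le> maturity P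
      then g1' P Q (x1 P i) (x2 P j) (tau P n) else 0)"

text \<open>
  The source term and the discrete mixed derivative at the Neumann nodes are not fixed by a formula:
  they may be any mesh functions (of time level and node) depending linearly on the Neumann datum.
\<close>

definition linear_in_datum :: "(neumann_data \<Rightarrow> nat \<Rightarrow> nat \<Rightarrow> nat \<Rightarrow> real) \<Rightarrow> bool" where
  "linear_in_datum L \<longleftrightarrow>
     (\<forall>\<gamma> \<delta> n i j. L (\<lambda>Q m k l. \<gamma> Q m k l + \<delta> Q m k l) n i j = L \<gamma> n i j + L \<delta> n i j) \<and>
     (\<forall>c \<gamma> n i j. L (\<lambda>Q m k l. c * \<gamma> Q m k l) n i j = c * L \<gamma> n i j)"


section \<open>Difference quotients\<close>

text \<open>
  The backward quotients are only meant for indices at least 1, where \<open>i - 1\<close> is not truncated.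
\<close>

type_synonym mesh_fun = "nat \<Rightarrow> nat \<Rightarrow> real"

definition fd1 :: "option_problem \<Rightarrow> mesh_fun \<Rightarrow> mesh_fun" where
  "fd1 P u = (\<lambda>i j. (u (i + 1) j - u i j) / h1 P)"
definition bd1 :: "option_problem \<Rightarrow> mesh_fun \<Rightarrow> mesh_fun" where
  "bd1 P u = (\<lambda>i j. (u i j - u (i - 1) j) / h1 P)"
definition cd1 :: "option_problem \<Rightarrow> mesh_fun \<Rightarrow> mesh_fun" where
  "cd1 P u = (\<lambda>i j. (fd1 P u i j + bd1 P u i j) / 2)"

definition fd2 :: "option_problem \<Rightarrow> mesh_fun \<Rightarrow> mesh_fun" where
  "fd2 P u = (\<lambda>i j. (u i (j + 1) - u i j) / h2 P)"
definition bd2 :: "option_problem \<Rightarrow> mesh_fun \<Rightarrow> mesh_fun" where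
  "bd2 P u = (\<lambda>i j. (u i j - u i (j - 1)) / h2 P)"
definition cd2 :: "option_problem \<Rightarrow> mesh_fun \<Rightarrow> mesh_fun" where
  "cd2 P u = (\<lambda>i j. (fd2 P u i j + bd2 P u i j) / 2)"

definition mixed_plus :: "option_problem \<Rightarrow> mesh_fun \<Rightarrow> mesh_fun" where
  "mixed_plus P u = (\<lambda>i j. (fd2 P (fd1 P u) i j + bd2 P (bd1 P u) i j) / 2)"
definition mixed_minus :: "option_problem \<Rightarrow> mesh_fun \<Rightarrow> mesh_fun" where
  "mixed_minus P u = (\<lambda>i j. (fd2 P (bd1 P u) i j + bd2 P (fd1 P u) i j) / 2)"


section \<open>Flux limiter\<close>

definition van_leer :: "real \<Rightarrow> real" where
  "van_leer \<theta> = (\<bar>\<theta>\<bar> + \<theta>) / (1 + \<bar>\<theta>\<bar>)"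

definition extrapolate :: "option_problem \<Rightarrow> mesh_fun \<Rightarrow> mesh_fun" where
  "extrapolate P u = (\<lambda>i j.
     if i = 0 then 3 * u 1 j - 3 * u 2 j + u 3 j
     else if i = N1 P + 1 then 3 * u (N1 P) j - 3 * u (N1 P - 1) j + u (N1 P - 2) j
     else if j = 0 then 3 * u i 1 - 3 * u i 2 + u i 3
     else if j = N2 P + 1 then 3 * u i (N2 P) - 3 * u i (N2 P - 1) + u i (N2 P - 2)
     else u i j)"

text \<open>
  Where a quotient has zero denominator it is 0, as is the inverse of 0; the limiter is 0 there.
\<close>

definition theta1 :: "option_problem \<Rightarrow> mesh_fun \<Rightarrow> mesh_fun" where
  "theta1 P u = (\<lambda>i j. fd1 P (extrapolate P u) i j / bd1 P (extrapolate P u) i j)"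
definition theta2 :: "option_problem \<Rightarrow> mesh_fun \<Rightarrow> mesh_fun" where
  "theta2 P u = (\<lambda>i j. fd2 P (extrapolate P u) i j / bd2 P (extrapolate P u) i j)"

definition Lam1_plus :: "option_problem \<Rightarrow> mesh_fun \<Rightarrow> mesh_fun" where
  "Lam1_plus P u = (\<lambda>i j.
     1 + van_leer (inverse (theta1 P u i j)) / 2 - van_leer (theta1 P u (i + 1) j) / 2)"
definition Lam1_minus :: "option_problem \<Rightarrow> mesh_fun \<Rightarrow> mesh_fun" where
  "Lam1_minus P u = (\<lambda>i j.
     1 + van_leer (theta1 P u i j) / 2 - van_leer (inverse (theta1 P u (i - 1) j)) / 2)"
definition Lam2_plus :: "option_problem \<Rightarrow> mesh_fun \<Rightarrow> mesh_fun" where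
  "Lam2_plus P u = (\<lambda>i j.
     1 + van_leer (inverse (theta2 P u i j)) / 2 - van_leer (theta2 P u i (j + 1)) / 2)"
definition Lam2_minus :: "option_problem \<Rightarrow> mesh_fun \<Rightarrow> mesh_fun" where
  "Lam2_minus P u = (\<lambda>i j.
     1 + van_leer (theta2 P u i j) / 2 - van_leer (inverse (theta2 P u i (j - 1))) / 2)"


section \<open>The scheme\<close>

text \<open>
  The upwind fluxes for positive and negative drift; on a Neumann side only the quotient that
  stays inside the mesh is kept.
\<close>

definition K1_plus :: "option_problem \<Rightarrow> mesh_fun \<Rightarrow> mesh_fun" where
  "K1_plus P u = (\<lambda>i j. pos (A1 P) * Lam1_plus P u i j * fd1 P u i j)"
definition K1_minus :: "option_problem \<Rightarrow> mesh_fun \<Rightarrow> mesh_fun" where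
  "K1_minus P u = (\<lambda>i j. neg (A1 P) * Lam1_minus P u i j * bd1 P u i j)"
definition K2_plus :: "option_problem \<Rightarrow> mesh_fun \<Rightarrow> mesh_fun" where
  "K2_plus P u = (\<lambda>i j. pos (A2 P) * Lam2_plus P u i j * fd2 P u i j)"
definition K2_minus :: "option_problem \<Rightarrow> mesh_fun \<Rightarrow> mesh_fun" where
  "K2_minus P u = (\<lambda>i j. neg (A2 P) * Lam2_minus P u i j * bd2 P u i j)"

definition K :: "option_problem \<Rightarrow> mesh_fun \<Rightarrow> mesh_fun" where
  "K P u = (\<lambda>i j.
     (if i = 1 then K1_plus P u i j
      else if i = N1 P then - K1_minus P u i j
      else K1_plus P u i j - K1_minus P u i j) +
     (if j = 1 then K2_plus P u i j
      else if j = N2 P then - K2_minus P u i j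
      else K2_plus P u i j - K2_minus P u i j))"

definition B :: "option_problem \<Rightarrow> mesh_fun \<Rightarrow> mesh_fun \<Rightarrow> mesh_fun" where
  "B P \<rho> u = (\<lambda>i j.
     if i = 1 \<and> j = N2 P then
       - ((sigma1 P)\<^sup>2 / h1 P) * fd1 P u i j + ((sigma2 P)\<^sup>2 / h2 P) * bd2 P u i j
       + kappa P * \<bar>\<rho> i j\<bar> * bd2 P (fd1 P u) i j
     else if i = N1 P \<and> j = N2 P then
       ((sigma1 P)\<^sup>2 / h1 P) * bd1 P u i j + ((sigma2 P)\<^sup>2 / h2 P) * bd2 P u i j
       - kappa P * \<bar>\<rho> i j\<bar> * bd2 P (bd1 P u) i j
     else if i = N1 P \<and> j = 1 then
       ((sigma1 P)\<^sup>2 / h1 P) * bd1 P u i j - ((sigma2 P)\<^sup>2 / h2 P) * fd2 P u i j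
       + kappa P * \<bar>\<rho> i j\<bar> * fd2 P (bd1 P u) i j
     else if i = 1 \<and> j = 1 then
       - ((sigma1 P)\<^sup>2 / h1 P) * fd1 P u i j - ((sigma2 P)\<^sup>2 / h2 P) * fd2 P u i j
       - kappa P * \<bar>\<rho> i j\<bar> * fd2 P (fd1 P u) i j
     else if i = 1 then
       - ((sigma1 P)\<^sup>2 / h1 P) * fd1 P u i j - (sigma2 P)\<^sup>2 / 2 * fd2 P (bd2 P u) i j
       - kappa P / 2 * \<bar>\<rho> i j\<bar> * (fd2 P (fd1 P u) i j - bd2 P (fd1 P u) i j)
     else if i = N1 P then
       ((sigma1 P)\<^sup>2 / h1 P) * bd1 P u i j - (sigma2 P)\<^sup>2 / 2 * fd2 P (bd2 P u) i j
       - kappa P / 2 * \<bar>\<rho> i j\<bar> * (bd2 P (bd1 P u) i j - fd2 P (bd1 P u) i j)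
     else if j = N2 P then
       - ((sigma1 P)\<^sup>2 / 2) * fd1 P (bd1 P u) i j + ((sigma2 P)\<^sup>2 / h2 P) * bd2 P u i j
       - kappa P / 2 * \<bar>\<rho> i j\<bar> * (bd2 P (bd1 P u) i j - bd2 P (fd1 P u) i j)
     else if j = 1 then
       - ((sigma1 P)\<^sup>2 / 2) * fd1 P (bd1 P u) i j - ((sigma2 P)\<^sup>2 / h2 P) * fd2 P u i j
       - kappa P / 2 * \<bar>\<rho> i j\<bar> * (fd2 P (fd1 P u) i j - fd2 P (bd1 P u) i j)
     else
       - ((sigma1 P)\<^sup>2 / 2) * fd1 P (bd1 P u) i j - (sigma2 P)\<^sup>2 / 2 * fd2 P (bd2 P u) i j
       - kappa P * (pos (\<rho> i j) * mixed_plus P u i j - neg (\<rho> i j) * mixed_minus P u i j))"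

text \<open>
  \<open>rho' P M u m\<close> is evaluated at time level \<open>m\<close>; \<open>M\<close> maps the Neumann datum to the discrete mixed
  derivative at the Neumann nodes.
\<close>

definition rho' :: "option_problem \<Rightarrow> (neumann_data \<Rightarrow> nat \<Rightarrow> nat \<Rightarrow> nat \<Rightarrow> real) \<Rightarrow>
    (nat \<Rightarrow> mesh_fun) \<Rightarrow> nat \<Rightarrow> mesh_fun" where
  "rho' P M u m = (\<lambda>i j.
     if (i, j) \<in> inner_nodes P then rho P (cd2 P (cd1 P (u m)) i j)
     else rho P (M (neumann_datum P) m i j))"

definition numerical_solution :: "option_problem \<Rightarrow>
    (neumann_data \<Rightarrow> nat \<Rightarrow> nat \<Rightarrow> nat \<Rightarrow> real) \<Rightarrow> (neumann_data \<Rightarrow> nat \<Rightarrow> nat \<Rightarrow> nat \<Rightarrow> real) \<Rightarrow>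
    (nat \<Rightarrow> mesh_fun) \<Rightarrow> bool" where
  "numerical_solution P F M u \<longleftrightarrow>
     (\<forall>(i, j)\<in>nodes P. u 0 i j = g0' P (x1 P i) (x2 P j)) \<and>
     (\<forall>n\<ge>1. tau P n \<le> maturity P \<longrightarrow>
        (\<forall>(i, j)\<in>inner_nodes P \<union> neumann_nodes P.
           (u n i j - u (n - 1) i j) / dt P + B P (rho' P M u (n - 1)) (u n) i j
             + rate P * u n i j
           = K P (u (n - 1)) i j + F (neumann_datum P) n i j) \<and>
        (\<forall>(i, j)\<in>dirichlet_nodes P. u n i j = g2' P (x1 P i) (x2 P j) (tau P n)))"

text \<open>The mesh solution of the original problem: \<open>S = exp x\<close> and calendar time \<open>T - \<tau>\<close>.\<close>

definition original_numerical_solution :: "option_problem \<Rightarrow> (nat \<Rightarrow> mesh_fun) \<Rightarrow>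
    (real \<Rightarrow> real \<Rightarrow> real \<Rightarrow> real) \<Rightarrow> bool" where
  "original_numerical_solution P u V \<longleftrightarrow>
     (\<forall>n. tau P n \<le> maturity P \<longrightarrow>
        (\<forall>(i, j)\<in>nodes P. V (exp (x1 P i)) (exp (x2 P j)) (maturity P - tau P n) = u n i j))"


section \<open>Mesh conditions and stability\<close>

definition b :: "option_problem \<Rightarrow> side \<Rightarrow> nat" where
  "b P Q = (if Q \<in> dirichlet P then 1 else 0)"

definition max_abs_rho :: "option_problem \<Rightarrow> mesh_fun \<Rightarrow> real" where
  "max_abs_rho P \<rho> = Max ((\<lambda>(i, j). \<bar>\<rho> i j\<bar>) `
     ({1 + b P West..N1 P - b P East} \<times> {1 + b P South..N2 P - b P North}))"

text \<open>
  An upper bound whose denominator vanishes is infinite, i.e. no restriction; hence the premises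
  of the implications here and in \<open>time_step_condition\<close>.
\<close>

definition mesh_ratio_condition :: "option_problem \<Rightarrow> mesh_fun \<Rightarrow> bool" where
  "mesh_ratio_condition P \<rho> \<longleftrightarrow>
     sigma1 P / sigma2 P * max_abs_rho P \<rho> \<le> h1 P / h2 P \<and>
     (max_abs_rho P \<rho> \<noteq> 0 \<longrightarrow> h1 P / h2 P \<le> sigma1 P / (sigma2 P * max_abs_rho P \<rho>))"

definition time_step_condition :: "option_problem \<Rightarrow> bool" where
  "time_step_condition P \<longleftrightarrow>
     (A1 P \<noteq> 0 \<or> A2 P \<noteq> 0 \<longrightarrow>
        dt P \<le> h1 P * h2 P / (2 * (\<bar>A1 P\<bar> * h2 P + \<bar>A2 P\<bar> * h1 P)))"

definition mesh_norm :: "option_problem \<Rightarrow> mesh_fun \<Rightarrow> real" where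
  "mesh_norm P v = Max ((\<lambda>(i, j). \<bar>v i j\<bar>) ` nodes P)"

definition dirichlet_max :: "option_problem \<Rightarrow> (nat \<Rightarrow> mesh_fun) \<Rightarrow> real" where
  "dirichlet_max P w = Max {w m i j | m i j. tau P m \<le> maturity P \<and> (i, j) \<in> dirichlet_nodes P}"

text \<open>
  Stability is the a priori bound of the solution by its initial and Dirichlet data with constant 1,
  independent of the mesh. A factor \<open>T\<close> in front of the Dirichlet maximum would be wrong for
  \<open>T < 1\<close>, since the solution equals the datum on the Dirichlet part; for \<open>T \<ge> 1\<close> (and
  nonnegative datum) the bound with this factor follows.
\<close>

definition stable_transformed :: "option_problem \<Rightarrow> (nat \<Rightarrow> mesh_fun) \<Rightarrow> bool" where
  "stable_transformed P u \<longleftrightarrow>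
     (\<forall>n. tau P n \<le> maturity P \<longrightarrow>
        mesh_norm P (u n) \<le>
          max (mesh_norm P (\<lambda>i j. g0' P (x1 P i) (x2 P j)))
              (dirichlet_max P (\<lambda>m i j. g2' P (x1 P i) (x2 P j) (tau P m))))"

definition stable_original :: "option_problem \<Rightarrow> (real \<Rightarrow> real \<Rightarrow> real \<Rightarrow> real) \<Rightarrow> bool" where
  "stable_original P V \<longleftrightarrow>
     (\<forall>n. tau P n \<le> maturity P \<longrightarrow>
        mesh_norm P (\<lambda>i j. V (exp (x1 P i)) (exp (x2 P j)) (maturity P - tau P n)) \<le>
          max (mesh_norm P (\<lambda>i j. g0 P (exp (x1 P i)) (exp (x2 P j))))
              (dirichlet_max P (\<lambda>m i j. g2 P (exp (x1 P i)) (exp (x2 P j)) (tau P m))))"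

end

theory Submission
  imports Defs
begin

text \<open>
  By the mesh ratio condition every row of \<open>B\<close> has zero sum and nonpositive off-diagonal entries, so
  \<open>B\<close> is nonnegative at a node where the mesh function is maximal. The limiters lie between 0 and 2,
  hence by the time step condition \<open>u + dt * K u\<close> is at every node a convex combination of values
  of \<open>u\<close>. Evaluating the scheme at a node where \<open>\<bar>u n\<bar>\<close> is maximal therefore gives
  \<open>(1 + dt * rate) * \<bar>u n\<bar> \<le> \<parallel>u (n - 1)\<parallel>\<close> there, unless the node carries the Dirichlet datum.
\<close>

section \<open>The mesh\<close>

lemma h1_pos: "0 < LW P \<Longrightarrow> LW P < LE P \<Longrightarrow> N1 P \<ge> 2 \<Longrightarrow> h1 P > 0"
  by (simp add: h1_def)

lemma h2_pos: "0 < LS P \<Longrightarrow> LS P < LN P \<Longrightarrow> N2 P \<ge> 2 \<Longrightarrow> h2 P > 0"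
  by (simp add: h2_def)

text \<open>The exponent is the point of the segment from \<open>ln l\<close> to \<open>ln m\<close>
  with parameter \<open>?s\<close> between 0 and 1, and \<open>exp\<close> is monotone. Generic
  \<open>l\<close>, \<open>m\<close>, \<open>N\<close> serve both coordinate directions.\<close>

lemma exp_affine_node_bounds:
  fixes l m :: real
  assumes "0 < l" "l < m" "N \<ge> 2" "i \<in> {1..N}"
  shows "exp (ln l + (real i - 1) * ((ln m - ln l) / (real N - 1))) \<in> {l..m}"
proof -
  let ?s = "(real i - 1) / (real N - 1)"
  have s: "0 \<le> ?s" "?s \<le> 1" using assms(3,4) by auto
  have d: "0 \<le> ln m - ln l" using assms(1,2) by simp
  have "0 \<le> ?s * (ln m - ln l)" "?s * (ln m - ln l) \<le> 1 * (ln m - ln l)"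
    using s d by (intro mult_nonneg_nonneg mult_right_mono; simp)+
  then have "exp (ln l) \<le> exp (ln l + ?s * (ln m - ln l))"
    "exp (ln l + ?s * (ln m - ln l)) \<le> exp (ln m)" by simp_all
  then show ?thesis using assms(1,2) by simp
qed

lemma exp_x1_bounds:
  "0 < LW P \<Longrightarrow> LW P < LE P \<Longrightarrow> N1 P \<ge> 2 \<Longrightarrow> i \<in> {1..N1 P} \<Longrightarrow> exp (x1 P i) \<in> {LW P..LE P}"
  unfolding x1_def h1_def by (rule exp_affine_node_bounds)

lemma exp_x2_bounds:
  "0 < LS P \<Longrightarrow> LS P < LN P \<Longrightarrow> N2 P \<ge> 2 \<Longrightarrow> j \<in> {1..N2 P} \<Longrightarrow> exp (x2 P j) \<in> {LS P..LN P}"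
  unfolding x2_def h2_def by (rule exp_affine_node_bounds)

text \<open>Transfers the hypotheses on \<open>g1\<close> and \<open>g2\<close>, which are stated on
  the closed sides in price variables, to the mesh nodes.\<close>

lemma side_nodes_points:
  assumes "0 < LW P" "LW P < LE P" "0 < LS P" "LS P < LN P" "N1 P \<ge> 2" "N2 P \<ge> 2"
    and "(i, j) \<in> side_nodes P Q"
  shows "(exp (x1 P i), exp (x2 P j)) \<in> side_points P Q"
proof -
  have ends: "exp (x1 P (Suc 0)) = LW P" "exp (x1 P (N1 P)) = LE P"
    "exp (x2 P (Suc 0)) = LS P" "exp (x2 P (N2 P)) = LN P"
    using assms by (auto simp: x1_def x2_def h1_def h2_def)
  show ?thesis
    using assms(7) exp_x1_bounds[OF assms(1,2,5), of i] exp_x2_bounds[OF assms(3,4,6), of j]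
    by (cases Q) (auto simp: ends)
qed

section \<open>Classification of the nodes\<close>

text \<open>A node that is not inner has an extreme index and so lies on some side. A corner between
  a Dirichlet and a Neumann side falls to the Dirichlet nodes.\<close>

lemma nodes_cover: "nodes P \<subseteq> inner_nodes P \<union> neumann_nodes P \<union> dirichlet_nodes P"
proof
  fix q assume q: "q \<in> nodes P"
  obtain i j where ij: "q = (i, j)" by force
  show "q \<in> inner_nodes P \<union> neumann_nodes P \<union> dirichlet_nodes P"
  proof (cases "q \<in> inner_nodes P")
    case False
    with q have "i = 1 \<or> i = N1 P \<or> j = 1 \<or> j = N2 P"
      by (auto simp: ij nodes_def inner_nodes_def)
    then obtain Q where "(i, j) \<in> side_nodes P Q"
      using q by (auto simp: ij nodes_def intro: that[of West] that[of East] that[of South] that[of North])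
    then show ?thesis by (auto simp: ij neumann_nodes_def dirichlet_nodes_def)
  qed simp
qed

lemma dirichlet_nodes_subset: "N1 P \<ge> 1 \<Longrightarrow> N2 P \<ge> 1 \<Longrightarrow> dirichlet_nodes P \<subseteq> nodes P"
proof -
  assume "N1 P \<ge> 1" "N2 P \<ge> 1"
  then have "side_nodes P Q \<subseteq> nodes P" for Q by (cases Q) (auto simp: nodes_def)
  then show ?thesis by (auto simp: dirichlet_nodes_def)
qed

text \<open>The range on the right is the one over which \<open>max_abs_rho\<close> is formed, so
  the mesh ratio condition controls \<open>\<rho>\<close> at every node outside the Dirichlet
  part.\<close>

lemma non_dirichlet_index_range:
  assumes "(i, j) \<in> nodes P" "(i, j) \<notin> dirichlet_nodes P"
  shows "(i, j) \<in> {1 + b P West..N1 P - b P East} \<times> {1 + b P South..N2 P - b P North}"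
proof -
  have "i \<noteq> 1" if "West \<in> dirichlet P"
    using assms that by (force simp: dirichlet_nodes_def nodes_def)
  moreover have "i \<noteq> N1 P" if "East \<in> dirichlet P"
    using assms that by (force simp: dirichlet_nodes_def nodes_def)
  moreover have "j \<noteq> 1" if "South \<in> dirichlet P"
    using assms that by (force simp: dirichlet_nodes_def nodes_def)
  moreover have "j \<noteq> N2 P" if "North \<in> dirichlet P"
    using assms that by (force simp: dirichlet_nodes_def nodes_def)
  ultimately show ?thesis
    using assms(1) by (auto simp: nodes_def b_def)
qed

section \<open>Maximum norm and Dirichlet maximum as attained maxima\<close>

lemma finite_nodes: "finite (nodes P)"
  by (simp add: nodes_def)

lemma abs_le_mesh_norm: "(i, j) \<in> nodes P \<Longrightarrow> \<bar>v i j\<bar> \<le> mesh_norm P v"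
  unfolding mesh_norm_def by (rule Max_ge) (auto simp: finite_nodes intro: rev_image_eqI)

lemma mesh_norm_attained:
  assumes "nodes P \<noteq> {}"
  obtains i j where "(i, j) \<in> nodes P" "mesh_norm P v = \<bar>v i j\<bar>"
proof -
  have "mesh_norm P v \<in> (\<lambda>(i, j). \<bar>v i j\<bar>) ` nodes P"
    unfolding mesh_norm_def using assms by (intro Max_in) (auto simp: finite_nodes)
  then show ?thesis using that by auto
qed

lemma mesh_norm_cong:
  "(\<And>i j. (i, j) \<in> nodes P \<Longrightarrow> v i j = w i j) \<Longrightarrow> mesh_norm P v = mesh_norm P w"
  unfolding mesh_norm_def by (intro arg_cong[where f = Max] image_cong) auto

lemma le_dirichlet_max:
  assumes "dt P > 0" "N1 P \<ge> 1" "N2 P \<ge> 1" "tau P m \<le> maturity P" "(i, j) \<in> dirichlet_nodes P"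
  shows "w m i j \<le> dirichlet_max P w"
proof -
  \<comment> \<open>\<open>Max\<close> is an upper bound only on a finite set. Positivity of
    \<open>dt P\<close> leaves finitely many time levels up to maturity.\<close>
  have "{m. tau P m \<le> maturity P} \<subseteq> {..nat \<lfloor>maturity P / dt P\<rfloor>}"
    using assms(1) by (auto simp: tau_def field_simps intro!: le_nat_floor)
  then have "finite {m. tau P m \<le> maturity P}" by (rule finite_subset) simp
  moreover have "finite (dirichlet_nodes P)"
    using dirichlet_nodes_subset[OF assms(2,3)] finite_nodes by (rule finite_subset)
  moreover have "{w m i j | m i j. tau P m \<le> maturity P \<and> (i, j) \<in> dirichlet_nodes P}
      = (\<lambda>(m, i, j). w m i j) ` ({m. tau P m \<le> maturity P} \<times> dirichlet_nodes P)"
    by (auto intro: rev_image_eqI)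
  ultimately have "finite {w m i j | m i j. tau P m \<le> maturity P \<and> (i, j) \<in> dirichlet_nodes P}"
    by simp
  then show ?thesis unfolding dirichlet_max_def by (rule Max_ge) (use assms(4,5) in blast)
qed


section \<open>The implicit part\<close>

text \<open>For a fixed correlation field the operator is linear. The sign change reduces a minimum
  of a mesh function to a maximum.\<close>

lemma B_uminus: "B P \<rho> (\<lambda>i j. - u i j) i j = - B P \<rho> u i j"
  unfolding B_def fd1_def fd2_def bd1_def bd2_def mixed_plus_def mixed_minus_def
  by (simp add: minus_divide_left[symmetric] add_divide_distrib diff_divide_distrib algebra_simps)

text \<open>The two halves of the mesh ratio condition with cleared denominators, localized at one
  node; they give the weights of \<open>B\<close> their signs.\<close>

lemma mesh_ratio_conditionD:
  assumes "mesh_ratio_condition P \<rho>" "(i, j) \<in> nodes P" "(i, j) \<notin> dirichlet_nodes P"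
    and "sigma1 P > 0" "sigma2 P > 0" "h1 P > 0" "h2 P > 0"
  shows "sigma1 P / h1 P * \<bar>\<rho> i j\<bar> \<le> sigma2 P / h2 P"
    and "sigma2 P / h2 P * \<bar>\<rho> i j\<bar> \<le> sigma1 P / h1 P"
proof -
  let ?m = "max_abs_rho P \<rho>"
  have m: "\<bar>\<rho> i j\<bar> \<le> ?m"
    unfolding max_abs_rho_def using non_dirichlet_index_range[OF assms(2,3)]
    by (intro Max_ge) (auto intro: rev_image_eqI)
  have "sigma1 P / h1 P * ?m \<le> sigma2 P / h2 P"
    using assms(1,4-7) by (simp add: mesh_ratio_condition_def field_simps)
  then show "sigma1 P / h1 P * \<bar>\<rho> i j\<bar> \<le> sigma2 P / h2 P"
    using m assms(4,6) by (meson divide_nonneg_pos less_imp_le mult_left_mono order_trans)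
  have "sigma2 P / h2 P * ?m \<le> sigma1 P / h1 P"
  \<comment> \<open>For \<open>?m = 0\<close> the condition has no upper bound to offer, but then
    the left-hand side is 0.\<close>
  proof (cases "?m = 0")
    case False
    with m have "?m > 0" by linarith
    then show ?thesis
      using assms(1,4-7) by (simp add: mesh_ratio_condition_def field_simps)
  qed (use assms in simp)
  then show "sigma2 P / h2 P * \<bar>\<rho> i j\<bar> \<le> sigma1 P / h1 P"
    using m assms(5,7) by (meson divide_nonneg_pos less_imp_le mult_left_mono order_trans)
qed

text \<open>Each of the stencils is rewritten as a combination of the differences
  \<open>u i j - u k l\<close> with nonnegative weights. A mixed quotient gives weight to a diagonal
  neighbour and takes it from axis neighbours; the ratio assumptions ensure that the latter can
  afford it.\<close>

lemma B_nonneg_at_max: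
  assumes pos: "sigma1 P > 0" "sigma2 P > 0" "h1 P > 0" "h2 P > 0"
    and ratio: "sigma1 P / h1 P * \<bar>\<rho> i j\<bar> \<le> sigma2 P / h2 P"
      "sigma2 P / h2 P * \<bar>\<rho> i j\<bar> \<le> sigma1 P / h1 P"
    and N: "N1 P \<ge> 2" "N2 P \<ge> 2" and ij: "(i, j) \<in> nodes P"
    and max: "\<And>k l. (k, l) \<in> nodes P \<Longrightarrow> u k l \<le> u i j"
  shows "B P \<rho> u i j \<ge> 0"
proof -
  \<comment> \<open>\<open>a\<close> and \<open>c\<close> are the volatilities per mesh width; with
    them all powers of \<open>h1 P\<close> and \<open>h2 P\<close> cancel.\<close>
  obtain a c where sig: "sigma1 P = a * h1 P" "sigma2 P = c * h2 P"
    using pos by (metis nonzero_divide_eq_eq less_irrefl)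
  have ac: "a \<ge> 0" "c \<ge> 0" "a * \<bar>\<rho> i j\<bar> \<le> c" "c * \<bar>\<rho> i j\<bar> \<le> a"
    using pos ratio by (auto simp: sig zero_less_mult_iff)
  define X Y Z where "X = a * a" and "Y = c * c" and "Z = a * c * \<bar>\<rho> i j\<bar>"
  note XYZ = this
  define d where "d k l = u i j - u k l" for k l
  \<comment> \<open>\<open>X - Z = a * (a - c * \<bar>\<rho> i j\<bar>)\<close> and
    \<open>Y - Z = c * (c - a * \<bar>\<rho> i j\<bar>)\<close>, so these signs are the two ratio
    assumptions.\<close>
  have Z: "Z \<ge> 0" "X - Z \<ge> 0" "Y - Z \<ge> 0"
    using mult_left_mono[OF ac(3) ac(2)] mult_left_mono[OF ac(4) ac(1)] ac(1,2)
    by (auto simp: XYZ mult_ac)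
  have d: "d k l \<ge> 0" if "k \<in> {1..N1 P}" "l \<in> {1..N2 P}" for k l
    using max[of k l] that by (simp add: d_def nodes_def)
  have h: "h1 P \<noteq> 0" "h2 P \<noteq> 0" using pos by auto
  \<comment> \<open>Rewrite rules for the patterns in \<open>B\<close>: first the one-sided boundary
    terms, then the second differences. Below, \<open>c1\<close>, \<open>c2\<close> and
    \<open>c3\<close> do the same for the mixed terms at corners, on sides and at inner
    nodes.\<close>
  have x: "(sigma1 P)\<^sup>2 / h1 P * (t / h1 P) = X * t" "(sigma2 P)\<^sup>2 / h2 P * (t / h2 P) = Y * t"
    "(sigma1 P)\<^sup>2 / 2 * ((t / h1 P - t' / h1 P) / h1 P) = X / 2 * (t - t')"
    "(sigma2 P)\<^sup>2 / 2 * ((t / h2 P - t' / h2 P) / h2 P) = Y / 2 * (t - t')" for t t'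
    using h by (simp_all add: sig XYZ power2_eq_square diff_divide_distrib[symmetric])
  have m: "(t / h1 P - t' / h1 P) / h2 P = (t - t') / (h1 P * h2 P)" for t t'
    by (simp add: diff_divide_distrib)
  have k: "kappa P = a * c * (h1 P * h2 P)" by (simp add: kappa_def sig)
  have c1: "a * c * (h1 P * h2 P) * r * (t / (h1 P * h2 P)) = a * c * r * t"
    and c2: "a * c * (h1 P * h2 P) / 2 * r * (t / (h1 P * h2 P) - t' / (h1 P * h2 P)) = a * c * r / 2 * (t - t')"
    and c3: "a * c * (h1 P * h2 P) * (r * ((t / (h1 P * h2 P) + t' / (h1 P * h2 P)) / 2)
        - r' * ((s / (h1 P * h2 P) + s' / (h1 P * h2 P)) / 2))
      = a * c / 2 * (r * (t + t') - r' * (s + s'))" for r r' s s' t t'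
    using h by (simp_all add: field_simps)
  note B_eq = B_def fd1_def fd2_def bd1_def bd2_def mixed_plus_def mixed_minus_def
  note simps = mult_minus_left x m k c1 c2 c3
  note ds = d_def XYZ
  have i: "i \<in> {1..N1 P}" and j: "j \<in> {1..N2 P}" using ij by (auto simp: nodes_def)
  \<comment> \<open>The order is that of the branches of \<open>B\<close>: corners NW, NE, SE, SW,
    then sides West, East, North, South, then the inner nodes.\<close>
  consider "i = 1" "j = N2 P" | "i = N1 P" "j = N2 P" | "i = N1 P" "j = 1" | "i = 1" "j = 1"
    | "i = 1" "j \<noteq> 1" "j \<noteq> N2 P" | "i = N1 P" "j \<noteq> 1" "j \<noteq> N2 P"
    | "i \<noteq> 1" "i \<noteq> N1 P" "j = N2 P" | "i \<noteq> 1" "i \<noteq> N1 P" "j = 1"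
    | "i \<noteq> 1" "i \<noteq> N1 P" "j \<noteq> 1" "j \<noteq> N2 P" by blast
  then show ?thesis
  proof cases
    case 1
    \<comment> \<open>At a corner the mixed quotient adds \<open>Z\<close> at the diagonal neighbour
      and subtracts \<open>Z\<close> at both axis neighbours.\<close>
    have "B P \<rho> u i j = (X - Z) * d (i + 1) j + (Y - Z) * d i (j - 1) + Z * d (i + 1) (j - 1)"
      unfolding B_eq simps using N 1 by (simp add: ds) (simp add: field_simps)
    then show ?thesis
      by (simp only:, intro add_nonneg_nonneg mult_nonneg_nonneg divide_nonneg_nonneg d) (use Z i j N 1 in auto)
  next
    case 2
    have "B P \<rho> u i j = (X - Z) * d (i - 1) j + (Y - Z) * d i (j - 1) + Z * d (i - 1) (j - 1)"
      unfolding B_eq simps using N 2 by (simp add: ds) (simp add: field_simps)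
    then show ?thesis
      by (simp only:, intro add_nonneg_nonneg mult_nonneg_nonneg divide_nonneg_nonneg d) (use Z i j N 2 in auto)
  next
    case 3
    have "B P \<rho> u i j = (X - Z) * d (i - 1) j + (Y - Z) * d i (j + 1) + Z * d (i - 1) (j + 1)"
      unfolding B_eq simps using N 3 by (simp add: ds) (simp add: field_simps)
    then show ?thesis
      by (simp only:, intro add_nonneg_nonneg mult_nonneg_nonneg divide_nonneg_nonneg d) (use Z i j N 3 in auto)
  next
    case 4
    have "B P \<rho> u i j = (X - Z) * d (i + 1) j + (Y - Z) * d i (j + 1) + Z * d (i + 1) (j + 1)"
      unfolding B_eq simps using N 4 by (simp add: ds) (simp add: field_simps)
    then show ?thesis
      by (simp only:, intro add_nonneg_nonneg mult_nonneg_nonneg divide_nonneg_nonneg d) (use Z i j N 4 in auto)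
  next
    case 5
    \<comment> \<open>Both mixed quotients involve the one horizontal neighbour, which loses
      \<open>Z\<close> in total; each vertical neighbour loses \<open>Z / 2\<close>.\<close>
    have "B P \<rho> u i j = (X - Z) * d (i + 1) j + (Y - Z) / 2 * (d i (j + 1) + d i (j - 1))
        + Z / 2 * (d (i + 1) (j + 1) + d (i + 1) (j - 1))"
      unfolding B_eq simps using N 5 j by (simp add: ds) (simp add: field_simps)
    then show ?thesis
      by (simp only:, intro add_nonneg_nonneg mult_nonneg_nonneg divide_nonneg_nonneg d) (use Z i j N 5 in auto)
  next
    case 6
    have "B P \<rho> u i j = (X - Z) * d (i - 1) j + (Y - Z) / 2 * (d i (j + 1) + d i (j - 1))
        + Z / 2 * (d (i - 1) (j + 1) + d (i - 1) (j - 1))"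
      unfolding B_eq simps using N 6 j by (simp add: ds) (simp add: field_simps)
    then show ?thesis
      by (simp only:, intro add_nonneg_nonneg mult_nonneg_nonneg divide_nonneg_nonneg d) (use Z i j N 6 in auto)
  next
    case 7
    have "B P \<rho> u i j = (Y - Z) * d i (j - 1) + (X - Z) / 2 * (d (i + 1) j + d (i - 1) j)
        + Z / 2 * (d (i + 1) (j - 1) + d (i - 1) (j - 1))"
      unfolding B_eq simps using N 7 i by (simp add: ds) (simp add: field_simps)
    then show ?thesis
      by (simp only:, intro add_nonneg_nonneg mult_nonneg_nonneg divide_nonneg_nonneg d) (use Z i j N 7 in auto)
  next
    case 8
    have "B P \<rho> u i j = (Y - Z) * d i (j + 1) + (X - Z) / 2 * (d (i + 1) j + d (i - 1) j)
        + Z / 2 * (d (i + 1) (j + 1) + d (i - 1) (j + 1))"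
      unfolding B_eq simps using N 8 i by (simp add: ds) (simp add: field_simps)
    then show ?thesis
      by (simp only:, intro add_nonneg_nonneg mult_nonneg_nonneg divide_nonneg_nonneg d) (use Z i j N 8 in auto)
  next
    case 9
    show ?thesis
    \<comment> \<open>The sign of the correlation selects the diagonal: \<open>mixed_plus\<close>
      reaches the neighbours NE and SW, \<open>mixed_minus\<close> NW and SE. Either way they
      receive the weight \<open>Z / 2\<close>.\<close>
    proof (cases "\<rho> i j \<ge> 0")
      case True
      then have r: "pos (\<rho> i j) = \<rho> i j" "neg (\<rho> i j) = 0" "\<bar>\<rho> i j\<bar> = \<rho> i j"
        by (auto simp: pos_def neg_def)
      have "B P \<rho> u i j = (X - Z) / 2 * (d (i + 1) j + d (i - 1) j)
          + (Y - Z) / 2 * (d i (j + 1) + d i (j - 1))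
          + Z / 2 * (d (i + 1) (j + 1) + d (i - 1) (j - 1))"
        unfolding B_eq simps using N 9 i j by (simp add: ds r) (simp add: field_simps)
      then show ?thesis
        by (simp only:, intro add_nonneg_nonneg mult_nonneg_nonneg divide_nonneg_nonneg d) (use Z i j N 9 in auto)
    next
      case False
      then have r: "pos (\<rho> i j) = 0" "neg (\<rho> i j) = - \<rho> i j" "\<bar>\<rho> i j\<bar> = - \<rho> i j"
        by (auto simp: pos_def neg_def)
      have "B P \<rho> u i j = (X - Z) / 2 * (d (i + 1) j + d (i - 1) j)
          + (Y - Z) / 2 * (d i (j + 1) + d i (j - 1))
          + Z / 2 * (d (i + 1) (j - 1) + d (i - 1) (j + 1))"
        unfolding B_eq simps using N 9 i j by (simp add: ds r) (simp add: field_simps)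
      then show ?thesis
        by (simp only:, intro add_nonneg_nonneg mult_nonneg_nonneg divide_nonneg_nonneg d) (use Z i j N 9 in auto)
    qed
  qed
qed


section \<open>The explicit part\<close>

text \<open>The limiter is 0 for negative arguments and \<open>2 * \<theta> / (1 + \<theta>)\<close>
  otherwise. No argument is excluded, so ratios with zero denominator are covered.\<close>

lemma van_leer_bounds: "0 \<le> van_leer \<theta>" "van_leer \<theta> \<le> 2"
  by (auto simp: van_leer_def field_simps)

lemma Lam_bounds:
  "0 \<le> Lam1_plus P u i j" "Lam1_plus P u i j \<le> 2" "0 \<le> Lam1_minus P u i j" "Lam1_minus P u i j \<le> 2"
  "0 \<le> Lam2_plus P u i j" "Lam2_plus P u i j \<le> 2" "0 \<le> Lam2_minus P u i j" "Lam2_minus P u i j \<le> 2"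
  unfolding Lam1_plus_def Lam1_minus_def Lam2_plus_def Lam2_minus_def
  using van_leer_bounds[of "inverse (theta1 P u i j)"] van_leer_bounds[of "theta1 P u (i + 1) j"]
    van_leer_bounds[of "theta1 P u i j"] van_leer_bounds[of "inverse (theta1 P u (i - 1) j)"]
    van_leer_bounds[of "inverse (theta2 P u i j)"] van_leer_bounds[of "theta2 P u i (j + 1)"]
    van_leer_bounds[of "theta2 P u i j"] van_leer_bounds[of "inverse (theta2 P u i (j - 1))"]
  by argo+

text \<open>Only one of \<open>pos a\<close>, \<open>neg a\<close> is nonzero, so a single upwind neighbour \<open>p\<close> occurs.\<close>

lemma upwind_flux:
  fixes f :: "nat \<Rightarrow> real"
  assumes "h > 0" "N \<ge> 2" "i \<in> {1..N}" "0 \<le> lp" "lp \<le> 2" "0 \<le> lm" "lm \<le> 2"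
  obtains p \<alpha> where "p \<in> {1..N}" "0 \<le> \<alpha>" "\<alpha> \<le> 2 * \<bar>a\<bar> / h"
    "(if i = 1 then pos a * lp * ((f (i + 1) - f i) / h)
      else if i = N then - (neg a * lm * ((f i - f (i - 1)) / h))
      else pos a * lp * ((f (i + 1) - f i) / h) - neg a * lm * ((f i - f (i - 1)) / h))
     = \<alpha> * (f p - f i)"
proof (cases "a \<ge> 0")
  case True
  show ?thesis
  \<comment> \<open>Positive drift looks to \<open>i + 1\<close>. At \<open>i = N\<close> that term
    is dropped from the flux, so weight 0 with \<open>p = i\<close> will do; negative drift at
    \<open>i = 1\<close> is the mirror image.\<close>
  proof (cases "i = N")
    case False
    have "lp * a \<le> 2 * a" using assms(5) True by (rule mult_right_mono)
    then have "a * lp / h \<le> 2 * \<bar>a\<bar> / h" using assms(1) True by (simp add: divide_right_mono mult.commute)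
    then show ?thesis
      using True False assms by (intro that[of "i + 1" "a * lp / h"]) (auto simp: pos_def neg_def)
  qed (use True assms in \<open>intro that[of i 0], auto simp: pos_def neg_def divide_nonpos_pos\<close>)
next
  case False
  show ?thesis
  proof (cases "i = 1")
    case i: False
    have "lm * (- a) \<le> 2 * (- a)" using assms(7) False by (intro mult_right_mono) auto
    then have "- a * lm / h \<le> 2 * \<bar>a\<bar> / h" using assms(1) False by (simp add: divide_right_mono mult.commute)
    then show ?thesis
      using False i assms
      by (intro that[of "i - 1" "- a * lm / h"])
        (auto simp: pos_def neg_def field_simps mult_nonpos_nonneg)
  qed (use False assms in \<open>intro that[of i 0], auto simp: pos_def neg_def divide_nonpos_pos\<close>)
qed

text \<open>The bound on \<open>dt P\<close> is the reciprocal of the bracket, which is the sum of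
  the largest upwind weights in the two directions. If both drifts vanish, the bracket is 0.\<close>

lemma time_step_conditionD:
  assumes "time_step_condition P" "dt P > 0" "h1 P > 0" "h2 P > 0"
  shows "dt P * (2 * \<bar>A1 P\<bar> / h1 P + 2 * \<bar>A2 P\<bar> / h2 P) \<le> 1"
proof (cases "A1 P = 0 \<and> A2 P = 0")
  case False
  have "\<bar>A1 P\<bar> * h2 P + \<bar>A2 P\<bar> * h1 P > 0"
    using False assms(3,4) by (auto intro: add_pos_nonneg add_nonneg_pos)
  then show ?thesis
    using False assms by (auto simp: time_step_condition_def field_simps)
qed simp

text \<open>The limiters depend nonlinearly on \<open>w\<close>, but only their range matters: for a
  given \<open>w\<close> the update averages the node and one upwind neighbour per
  direction.\<close>

lemma explicit_part_bound:
  assumes ts: "time_step_condition P" "dt P > 0" and h: "h1 P > 0" "h2 P > 0"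
    and N: "N1 P \<ge> 2" "N2 P \<ge> 2" and ij: "(i, j) \<in> nodes P"
    and C: "\<And>k l. (k, l) \<in> nodes P \<Longrightarrow> \<bar>w k l\<bar> \<le> C"
  shows "\<bar>w i j + dt P * K P w i j\<bar> \<le> C"
proof -
  have i: "i \<in> {1..N1 P}" and j: "j \<in> {1..N2 P}" using ij by (auto simp: nodes_def)
  obtain p \<alpha> where p: "p \<in> {1..N1 P}" "0 \<le> \<alpha>" "\<alpha> \<le> 2 * \<bar>A1 P\<bar> / h1 P"
    and K1: "(if i = 1 then K1_plus P w i j else if i = N1 P then - K1_minus P w i j
        else K1_plus P w i j - K1_minus P w i j) = \<alpha> * (w p j - w i j)"
    unfolding K1_plus_def K1_minus_def fd1_def bd1_def
    by (rule upwind_flux[OF h(1) N(1) i Lam_bounds(1-4), where f = "\<lambda>k. w k j"])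
  obtain q \<beta> where q: "q \<in> {1..N2 P}" "0 \<le> \<beta>" "\<beta> \<le> 2 * \<bar>A2 P\<bar> / h2 P"
    and K2: "(if j = 1 then K2_plus P w i j else if j = N2 P then - K2_minus P w i j
        else K2_plus P w i j - K2_minus P w i j) = \<beta> * (w i q - w i j)"
    unfolding K2_plus_def K2_minus_def fd2_def bd2_def
    by (rule upwind_flux[OF h(2) N(2) j Lam_bounds(5-8), where f = "w i"])
  \<comment> \<open>The weight left for the node itself; together with
    \<open>dt P * \<alpha>\<close> and \<open>dt P * \<beta>\<close> it sums to 1.\<close>
  define c where "c = 1 - dt P * (\<alpha> + \<beta>)"
  have "dt P * (\<alpha> + \<beta>) \<le> dt P * (2 * \<bar>A1 P\<bar> / h1 P + 2 * \<bar>A2 P\<bar> / h2 P)"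
    using p q ts(2) by (intro mult_left_mono add_mono) auto
  also have "\<dots> \<le> 1" by (rule time_step_conditionD[OF ts h])
  finally have c: "c \<ge> 0" by (simp add: c_def)
  have "w i j + dt P * K P w i j = c * w i j + dt P * \<alpha> * w p j + dt P * \<beta> * w i q"
    unfolding K_def K1 K2 c_def by (simp add: algebra_simps)
  also have "\<bar>\<dots>\<bar> \<le> c * \<bar>w i j\<bar> + dt P * \<alpha> * \<bar>w p j\<bar> + dt P * \<beta> * \<bar>w i q\<bar>"
    using abs_triangle_ineq[of "c * w i j + dt P * \<alpha> * w p j" "dt P * \<beta> * w i q"]
      abs_triangle_ineq[of "c * w i j" "dt P * \<alpha> * w p j"] c p(2) q(2) ts(2)
    by (simp add: abs_mult)
  also have "\<dots> \<le> c * C + dt P * \<alpha> * C + dt P * \<beta> * C"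
    using c p q i j ts(2) by (intro add_mono mult_left_mono C) (auto simp: nodes_def)
  also have "\<dots> = C" by (simp add: c_def algebra_simps)
  finally show ?thesis .
qed


section \<open>Discrete maximum principle\<close>

text \<open>Here \<open>v\<close> is the new and \<open>w\<close> the old level. Of
  \<open>\<rho>\<close> only its size at this one node matters, so it may come from the old level or
  from the Neumann datum.\<close>

lemma implicit_step_bound:
  assumes pos: "sigma1 P > 0" "sigma2 P > 0" "h1 P > 0" "h2 P > 0" "rate P \<ge> 0"
    and ts: "time_step_condition P" "dt P > 0"
    and N: "N1 P \<ge> 2" "N2 P \<ge> 2" and ij: "(i, j) \<in> nodes P"
    and ratio: "sigma1 P / h1 P * \<bar>\<rho> i j\<bar> \<le> sigma2 P / h2 P"
      "sigma2 P / h2 P * \<bar>\<rho> i j\<bar> \<le> sigma1 P / h1 P"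
    and max: "\<And>k l. (k, l) \<in> nodes P \<Longrightarrow> \<bar>v k l\<bar> \<le> \<bar>v i j\<bar>"
    and C: "\<And>k l. (k, l) \<in> nodes P \<Longrightarrow> \<bar>w k l\<bar> \<le> C"
    and scheme: "(v i j - w i j) / dt P + B P \<rho> v i j + rate P * v i j = K P w i j"
  shows "\<bar>v i j\<bar> \<le> C"
proof -
  let ?e = "w i j + dt P * K P w i j"
  have e: "\<bar>?e\<bar> \<le> C" by (rule explicit_part_bound) (use assms in auto)
  have eq: "?e = v i j + dt P * B P \<rho> v i j + dt P * rate P * v i j"
    unfolding scheme[symmetric] using ts(2) by (simp add: field_simps)
  show ?thesis
  \<comment> \<open>By its sign, \<open>v i j\<close> is the maximum or the minimum of
    \<open>v\<close>. In both cases the \<open>B\<close> term and the discount term have the sign of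
    \<open>v i j\<close>, which gives \<open>\<bar>v i j\<bar> \<le> \<bar>?e\<bar>\<close>.\<close>
  proof (cases "v i j \<ge> 0")
    case True
    have "v k l \<le> v i j" if "(k, l) \<in> nodes P" for k l
      using max[OF that] True by linarith
    then have "0 \<le> B P \<rho> v i j" using pos ratio N ij by (intro B_nonneg_at_max)
    then have "0 \<le> dt P * B P \<rho> v i j" "0 \<le> dt P * rate P * v i j" using True ts(2) pos(5) by simp_all
    then show ?thesis using e eq True by linarith
  next
    case False
    have "- v k l \<le> - v i j" if "(k, l) \<in> nodes P" for k l
      using max[OF that] False by linarith
    then have "0 \<le> B P \<rho> (\<lambda>i j. - v i j) i j" using pos ratio N ij by (intro B_nonneg_at_max)
    then have "dt P * B P \<rho> v i j \<le> 0" "dt P * rate P * v i j \<le> 0"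
      using False ts(2) pos(5) by (simp_all add: B_uminus mult_nonneg_nonpos)
    then show ?thesis using e eq False by linarith
  qed
qed

section \<open>Homogeneous Neumann data and the scheme at a single step\<close>

text \<open>The transformed datum is \<open>g1\<close> times an exponential factor, and elsewhere it
  is zero by its extension.\<close>

lemma neumann_datum_zero:
  assumes dom: "0 < LW P" "LW P < LE P" "0 < LS P" "LS P < LN P" "N1 P \<ge> 2" "N2 P \<ge> 2" "dt P > 0"
    and g1: "\<forall>Q\<in>- dirichlet P. \<forall>(S1, S2)\<in>side_points P Q. \<forall>t\<in>{0..maturity P}. g1 P S1 S2 t = 0"
  shows "neumann_datum P = (\<lambda>Q n i j. 0)"
proof (intro ext)
  fix Q n i j
  show "neumann_datum P Q n i j = 0"
  proof (cases "Q \<notin> dirichlet P \<and> (i, j) \<in> side_nodes P Q \<and> tau P n \<le> maturity P")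
    case True
    then have "(exp (x1 P i), exp (x2 P j)) \<in> side_points P Q"
      using side_nodes_points dom by blast
    moreover have "tau P n \<in> {0..maturity P}" using True dom(7) by (simp add: tau_def)
    ultimately have "g1 P (exp (x1 P i)) (exp (x2 P j)) (tau P n) = 0" using g1 True by fastforce
    then show ?thesis by (simp add: neumann_datum_def g1'_def)
  qed (auto simp: neumann_datum_def)
qed

text \<open>Homogeneity with factor 0, the zero datum being written as \<open>0 * 0\<close>. This
  removes the source term of the scheme.\<close>

lemma linear_in_datum_zero:
  assumes "linear_in_datum L"
  shows "L (\<lambda>Q m k l. 0) n i j = 0"
proof -
  have "L (\<lambda>Q m k l. 0 * (0::real)) n i j = 0 * L (\<lambda>Q m k l. 0) n i j"
    using assms by (simp only: linear_in_datum_def)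
  then show ?thesis by simp
qed

text \<open>Instances of the scheme at level \<open>Suc n\<close>, where \<open>n - 1\<close> turns
  into \<open>n\<close> as the induction on time needs it.\<close>

lemma
  assumes "numerical_solution P F M u" "tau P (Suc n) \<le> maturity P"
  shows numerical_solution_step: "(i, j) \<in> inner_nodes P \<union> neumann_nodes P \<Longrightarrow>
      (u (Suc n) i j - u n i j) / dt P + B P (rho' P M u n) (u (Suc n)) i j + rate P * u (Suc n) i j
      = K P (u n) i j + F (neumann_datum P) (Suc n) i j"
    and numerical_solution_dirichlet: "(i, j) \<in> dirichlet_nodes P \<Longrightarrow>
      u (Suc n) i j = g2' P (x1 P i) (x2 P j) (tau P (Suc n))"
proof -
  note sol = conjunct2[OF assms(1)[unfolded numerical_solution_def], rule_format, of "Suc n",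
    OF _ assms(2), simplified]
  show "(i, j) \<in> inner_nodes P \<union> neumann_nodes P \<Longrightarrow>
      (u (Suc n) i j - u n i j) / dt P + B P (rho' P M u n) (u (Suc n)) i j + rate P * u (Suc n) i j
      = K P (u n) i j + F (neumann_datum P) (Suc n) i j"
    using bspec[OF conjunct1[OF sol], of "(i, j)"] by simp
  show "(i, j) \<in> dirichlet_nodes P \<Longrightarrow>
      u (Suc n) i j = g2' P (x1 P i) (x2 P j) (tau P (Suc n))"
    using bspec[OF conjunct2[OF sol], of "(i, j)"] by simp
qed

theorem theorem6:
  fixes P :: option_problem
    and F M :: "neumann_data \<Rightarrow> nat \<Rightarrow> nat \<Rightarrow> nat \<Rightarrow> real"
    and u :: "nat \<Rightarrow> mesh_fun"
    and V :: "real \<Rightarrow> real \<Rightarrow> real \<Rightarrow> real"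
  assumes "sigma1 P > 0" and "sigma2 P > 0" and "rate P > 0" and "maturity P > 0"
    and "- 1 \<le> rho1 P" and "rho1 P \<le> rho2 P" and "rho2 P \<le> 1"
    and "rho1 P \<le> rho0 P" and "rho0 P \<le> rho2 P"
    and "0 < LW P" and "LW P < LE P" and "0 < LS P" and "LS P < LN P"
    and "N1 P \<ge> 3" and "N2 P \<ge> 3" and "dt P > 0"
    and "dirichlet P \<noteq> {}"
    and "linear_in_datum F" and "linear_in_datum M"
    and "\<And>\<gamma> n i j. (i, j) \<in> inner_nodes P \<Longrightarrow> F \<gamma> n i j = 0"
    and "numerical_solution P F M u"
    and "original_numerical_solution P u V"
    and "- dirichlet P = {} \<or>
         (- dirichlet P \<noteq> {} \<and>
          (\<forall>Q\<in>- dirichlet P. \<forall>(S1, S2)\<in>side_points P Q. \<forall>t\<in>{0..maturity P}. g1 P S1 S2 t = 0))"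
    and "\<forall>(S1, S2)\<in>closed_domain P. g0 P S1 S2 \<ge> 0"
    and "\<forall>Q\<in>dirichlet P. \<forall>(S1, S2)\<in>side_points P Q. \<forall>t\<in>{0..maturity P}. g2 P S1 S2 t \<ge> 0"
    and "\<forall>n\<ge>1. tau P n \<le> maturity P \<longrightarrow> mesh_ratio_condition P (rho' P M u (n - 1))"
    and "time_step_condition P"
  shows "stable_transformed P u \<and> stable_original P V"
proof -
  have N: "N1 P \<ge> 2" "N2 P \<ge> 2" "N1 P \<ge> 1" "N2 P \<ge> 1" using assms(14,15) by auto
  have h: "h1 P > 0" "h2 P > 0"
    using h1_pos[OF assms(10,11) N(1)] h2_pos[OF assms(12,13) N(2)] .
  have ne: "nodes P \<noteq> {}" using N by (auto simp: nodes_def)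
  \<comment> \<open>Without Neumann sides the quantification is vacuous, so both alternatives give
    the same statement.\<close>
  have "\<forall>Q\<in>- dirichlet P. \<forall>(S1, S2)\<in>side_points P Q. \<forall>t\<in>{0..maturity P}. g1 P S1 S2 t = 0"
    using assms(23) by blast
  then have F0: "F (neumann_datum P) n i j = 0" for n i j
    using neumann_datum_zero[OF assms(10-13) N(1,2) assms(16)] linear_in_datum_zero[OF assms(18)]
    by simp
  let ?g = "\<lambda>m i j. g2' P (x1 P i) (x2 P j) (tau P m)"
  let ?C = "max (mesh_norm P (\<lambda>i j. g0' P (x1 P i) (x2 P j))) (dirichlet_max P ?g)"
  \<comment> \<open>\<open>dirichlet_max\<close> is formed without absolute values; it bounds the
    modulus because \<open>g2\<close> is nonnegative.\<close>
  have g2: "\<bar>?g n i j\<bar> \<le> ?C" if n: "tau P n \<le> maturity P" and ij: "(i, j) \<in> dirichlet_nodes P" for n i j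
  proof -
    obtain Q where Q: "Q \<in> dirichlet P" "(i, j) \<in> side_nodes P Q"
      using ij by (auto simp: dirichlet_nodes_def)
    have "(exp (x1 P i), exp (x2 P j)) \<in> side_points P Q"
      using side_nodes_points[OF assms(10-13) N(1,2) Q(2)] .
    moreover have "tau P n \<in> {0..maturity P}" using n assms(16) by (simp add: tau_def)
    ultimately have "0 \<le> ?g n i j" using assms(25) Q(1) unfolding g2'_def by fastforce
    then show ?thesis
      using le_dirichlet_max[OF assms(16) N(3,4) n ij, of ?g] by simp
  qed
  have bound: "mesh_norm P (u n) \<le> ?C" if "tau P n \<le> maturity P" for n
    using that
  proof (induction n)
    case 0
    have "mesh_norm P (u 0) = mesh_norm P (\<lambda>i j. g0' P (x1 P i) (x2 P j))"
      using assms(21) by (intro mesh_norm_cong) (auto simp: numerical_solution_def)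
    then show ?case by simp
  next
    case (Suc n)
    have "tau P n \<le> maturity P" using Suc.prems assms(16) by (simp add: tau_def algebra_simps)
    then have IH: "mesh_norm P (u n) \<le> ?C" by (rule Suc.IH)
    obtain i j where ij: "(i, j) \<in> nodes P" and mx: "mesh_norm P (u (Suc n)) = \<bar>u (Suc n) i j\<bar>"
      using mesh_norm_attained[OF ne] by metis
    show ?case
    proof (cases "(i, j) \<in> dirichlet_nodes P")
      case True
      then have "u (Suc n) i j = ?g (Suc n) i j"
        using numerical_solution_dirichlet[OF assms(21) Suc.prems] by simp
      then show ?thesis using g2[OF Suc.prems True] mx by simp
    next
      case False
      then have "(i, j) \<in> inner_nodes P \<union> neumann_nodes P" using nodes_cover ij by blast
      then have scheme: "(u (Suc n) i j - u n i j) / dt P + B P (rho' P M u n) (u (Suc n)) i j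
          + rate P * u (Suc n) i j = K P (u n) i j"
        using numerical_solution_step[OF assms(21) Suc.prems] F0 by simp
      \<comment> \<open>The step to level \<open>Suc n\<close> uses the correlation at level
        \<open>n\<close>, matching the index \<open>n - 1\<close> in the hypothesis.\<close>
      have "mesh_ratio_condition P (rho' P M u n)"
        using assms(26)[rule_format, of "Suc n"] Suc.prems by simp
      note ratio = mesh_ratio_conditionD[OF this ij False assms(1,2) h]
      have "\<bar>u (Suc n) k l\<bar> \<le> \<bar>u (Suc n) i j\<bar>" if "(k, l) \<in> nodes P" for k l
        using abs_le_mesh_norm[OF that, of "u (Suc n)"] mx by simp
      then have "\<bar>u (Suc n) i j\<bar> \<le> mesh_norm P (u n)"
        by (rule implicit_step_bound[where v = "u (Suc n)" and w = "u n" and \<rho> = "rho' P M u n",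
            OF assms(1,2) h less_imp_le[OF assms(3)] assms(27,16) N(1,2) ij ratio _ _ scheme])
          (assumption, rule abs_le_mesh_norm)
      then show ?thesis using IH mx by linarith
    qed
  qed
  \<comment> \<open>At the nodes \<open>V\<close> is \<open>u\<close> in other variables, and the
    primed data are the original ones at \<open>exp\<close> of the node, so one bound yields both
    claims.\<close>
  have "mesh_norm P (\<lambda>i j. V (exp (x1 P i)) (exp (x2 P j)) (maturity P - tau P n)) = mesh_norm P (u n)"
    if "tau P n \<le> maturity P" for n
    using assms(22) that by (intro mesh_norm_cong) (auto simp: original_numerical_solution_def)
  then show ?thesis
    using bound by (simp add: stable_transformed_def stable_original_def g0'_def g2'_def)
qed

end
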